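(* Let $h(t)$ be a curve of real symmetric invertible $2\times2$ matrices solving $$2\dot K+K\,\Xi=(\Xi^2-\operatorname{tr}K^2)\,I,\qquad K:=h^{-1}\dot h,\quad \Xi:=\operatorname{tr}K.$$ Write $K=\hat K+\tfrac{\Xi}{2}I$ with $\hat K$ traceless, and $\Delta:=\det h$. Then $$\beta:=-\Delta\,\operatorname{tr}(\hat K^2)\qquad\text{and}\qquad C:=4\det K$$ are both constant along the flow, and $\Delta$ satisfies the first-order first integral $$(\Delta')^2=C\Delta^2-2\beta\Delta .$$ Moreover $C=2(\Xi^2-\operatorname{tr}K^2)$ (equivalently $\Xi^2-\operatorname{tr}K^2=2\det K$, the standard $2\times2$ identity), so $\beta\le0$ and $C$ are logically independent constraints: the sign of $\beta$ is controlled by $\operatorname{tr}\hat K^2$ (the spread of the eigenvalues of $K$), while $C$ is controlled by their product.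
   Context: $h(t)$ is a matrix-valued function of a real variable $t$; dots and primes denote $t$-derivatives and $I$ is the identity matrix. The displayed matrix equation is the $n=2$ case of the Kasner master equation $2\dot K+K\Xi=\frac{\Xi^2-\operatorname{tr}K^2}{n-1}I$ for a curve of symmetric $n\times n$ matrices $h(t)$. *)

theory Defs
  imports "HOL-Analysis.Analysis"
begin

definition kasner_K :: "(real \<Rightarrow> real^'n^'n) \<Rightarrow> real \<Rightarrow> real^'n^'n" where
  "kasner_K h t = matrix_inv (h t) ** vector_derivative h (at t)"

definition kasner_Xi :: "(real \<Rightarrow> real^'n^'n) \<Rightarrow> real \<Rightarrow> real" where
  "kasner_Xi h t = trace (kasner_K h t)"

(* The existence of the derivatives is required explicitly, since vector_derivative is a
   total function; differentiability of K is the second-order regularity of h. *)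
definition kasner_solution :: "real set \<Rightarrow> (real \<Rightarrow> real^2^2) \<Rightarrow> bool" where
  "kasner_solution J h \<longleftrightarrow>
     open J \<and> is_interval J \<and> J \<noteq> {} \<and>
     (\<forall>t\<in>J. transpose (h t) = h t \<and> invertible (h t) \<and>
        h differentiable (at t) \<and> kasner_K h differentiable (at t) \<and>
        2 *\<^sub>R vector_derivative (kasner_K h) (at t) + kasner_Xi h t *\<^sub>R kasner_K h t
          = ((kasner_Xi h t)\<^sup>2 - trace (kasner_K h t ** kasner_K h t)) *\<^sub>R mat 1)"

(* The unique traceless matrix whose sum with (Xi/2) I is K. *)
definition kasner_Khat :: "(real \<Rightarrow> real^2^2) \<Rightarrow> real \<Rightarrow> real^2^2" where
  "kasner_Khat h t = kasner_K h t - (kasner_Xi h t / 2) *\<^sub>R mat 1"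

definition kasner_Delta :: "(real \<Rightarrow> real^2^2) \<Rightarrow> real \<Rightarrow> real" where
  "kasner_Delta h t = det (h t)"

definition kasner_beta :: "(real \<Rightarrow> real^2^2) \<Rightarrow> real \<Rightarrow> real" where
  "kasner_beta h t = - kasner_Delta h t * trace (kasner_Khat h t ** kasner_Khat h t)"

definition kasner_C :: "(real \<Rightarrow> real^2^2) \<Rightarrow> real \<Rightarrow> real" where
  "kasner_C h t = 4 * det (kasner_K h t)"

(* The complex eigenvalues of a real 2x2 matrix, listed with algebraic multiplicity, i.e. the
   two roots of its characteristic polynomial. For indefinite h they need not be real. *)
definition eigenvalue_pair :: "real^2^2 \<Rightarrow> complex \<Rightarrow> complex \<Rightarrow> bool" where
  "eigenvalue_pair A l m \<longleftrightarrow>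
     (\<forall>z. det (mat z - map_matrix complex_of_real A) = (z - l) * (z - m))"

end

theory Submission
  imports Defs
begin

text \<open>
  In dimension two, Cayley--Hamilton turns the right-hand side of the Kasner equation into
  \<open>2 (det K) I\<close>. Taking the trace gives \<open>\<Xi>' = 2 det K - \<Xi>\<^sup>2 / 2\<close>, and differentiating the
  determinant gives \<open>(det K)' = 0\<close>. Together with Jacobi's formula \<open>\<Delta>' = \<Delta> \<Xi>\<close> and
  \<open>tr (Khat\<^sup>2) = \<Xi>\<^sup>2 / 2 - 2 det K\<close> this makes \<open>\<beta>\<close> constant and yields the first integral.

  For the independence of \<open>C\<close> and the sign of \<open>\<beta>\<close>, a solution of \<open>u'' = m u\<close> gives the diagonal
  Kasner solutions \<open>h = diag (\<plusminus>u\<^sup>2, u'\<^sup>2)\<close> with \<open>C = 16 m\<close>. The sign affects neither \<open>K\<close> nor the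
  Kasner equation, but it is the sign of \<open>\<Delta>\<close> and hence decides the sign of \<open>\<beta>\<close>.
\<close>

subsection \<open>Two-by-two matrices\<close>

lemma trace_2: "trace (A :: 'a::comm_semiring_1^2^2) = A$1$1 + A$2$2"
  by (simp add: trace_def sum_2)

lemma matrix_eq_2_iff:
  "A = B \<longleftrightarrow> A$1$1 = B$1$1 \<and> A$1$2 = B$1$2 \<and> A$2$1 = B$2$1 \<and> A$2$2 = B$2$2"
  for A B :: "'a^2^2"
  by (auto simp: vec_eq_iff forall_2)

lemma matrix_mult_nth_2: "(A ** B)$i$j = A$i$1 * B$1$j + A$i$2 * B$2$j"
  for A B :: "'a::comm_semiring_1^2^2"
  by (simp add: matrix_matrix_mult_def sum_2)

text \<open>This is the trace of the Cayley--Hamilton identity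
  \<open>A^2 = (trace A) A - (det A) I\<close>.\<close>

lemma trace_square_2: "trace (A ** A) = (trace A)\<^sup>2 - 2 * det A"
  for A :: "'a::comm_ring_1^2^2"
  by (simp add: trace_2 matrix_mult_nth_2 det_2 algebra_simps power2_eq_square)

text \<open>Removing the trace moves the eigenvalues to plus and minus half their difference, so the
  square has trace half the discriminant of the characteristic polynomial.\<close>

lemma trace_square_traceless_part_2:
  fixes A :: "real^2^2"
  defines "B \<equiv> A - (trace A / 2) *\<^sub>R mat 1"
  shows "trace (B ** B) = (trace A)\<^sup>2 / 2 - 2 * det A"
  unfolding B_def
  by (simp add: trace_2 matrix_mult_nth_2 det_2 mat_def field_simps power2_eq_square)

section \<open>Eigenvalues as roots of the characteristic polynomial\<close>

lemma eigenvalue_pair_iff: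
  "eigenvalue_pair A l m \<longleftrightarrow>
     l + m = complex_of_real (trace A) \<and> l * m = complex_of_real (det A)"
proof -
  have char_poly: "det (mat z - map_matrix complex_of_real A)
      = z\<^sup>2 - complex_of_real (trace A) * z + complex_of_real (det A)" for z
    by (simp add: det_2 trace_2 mat_def algebra_simps power2_eq_square)
  have factored: "(z - l) * (z - m) = z\<^sup>2 - (l + m) * z + l * m" for z :: complex
    by (simp add: algebra_simps power2_eq_square)
  show ?thesis
  proof
    assume "eigenvalue_pair A l m"
    then have eq: "z\<^sup>2 - complex_of_real (trace A) * z + complex_of_real (det A)
        = z\<^sup>2 - (l + m) * z + l * m" for z
      unfolding eigenvalue_pair_def char_poly factored by blast
    \<comment> \<open>Both sides of \<open>eq\<close> are monic quadratics, so the values at 0 and 1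
      determine the remaining coefficients.\<close>
    have "l * m = complex_of_real (det A)" using eq[of 0] by simp
    moreover from this have "l + m = complex_of_real (trace A)"
      using eq[of 1] by (simp add: algebra_simps add_eq_0_iff)
    ultimately show "l + m = complex_of_real (trace A) \<and> l * m = complex_of_real (det A)"
      by simp
  qed (simp add: eigenvalue_pair_def char_poly factored)
qed

text \<open>The quadratic formula applies whatever the sign of the discriminant, since the square
  root is taken in the complex numbers.\<close>

lemma eigenvalue_pair_exists: "\<exists>l m. eigenvalue_pair A l m"
proof -
  define s where "s = csqrt (complex_of_real ((trace A)\<^sup>2 - 4 * det A))"
  have "s * s = complex_of_real ((trace A)\<^sup>2 - 4 * det A)"
    unfolding s_def by (metis power2_csqrt power2_eq_square)
  then have "eigenvalue_pair A ((trace A + s) / 2) ((trace A - s) / 2)"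
    unfolding eigenvalue_pair_iff by (simp add: field_simps power2_eq_square)
  then show ?thesis by blast
qed

lemma eigenvalue_pair_discriminant:
  assumes "eigenvalue_pair A l m"
  shows "(l - m)\<^sup>2 = complex_of_real ((trace A)\<^sup>2 - 4 * det A)"
proof -
  have "(l - m)\<^sup>2 = (l + m)\<^sup>2 - 4 * (l * m)"
    by (simp add: algebra_simps power2_eq_square)
  then show ?thesis using assms by (simp add: eigenvalue_pair_iff)
qed

section \<open>Entrywise differentiation of matrix curves\<close>

lemma has_field_derivative_entry:
  fixes h :: "real \<Rightarrow> real^'n^'m"
  assumes "(h has_vector_derivative D) (at t)"
  shows "((\<lambda>t. h t $ i $ j) has_field_derivative D $ i $ j) (at t)"
proof -
  have "bounded_linear (\<lambda>x :: real^'n^'m. x $ i $ j)"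
    by (intro bounded_linear_compose[OF bounded_linear_vec_nth bounded_linear_vec_nth])
  from bounded_linear.has_vector_derivative[OF this assms] show ?thesis
    by (simp add: has_real_derivative_iff_has_vector_derivative)
qed

text \<open>Serves two curves: for \<open>h\<close> it leads to Jacobi's formula, for
  \<open>K\<close> to the conservation of \<open>det K\<close>.\<close>

lemma has_field_derivative_det_2:
  fixes h :: "real \<Rightarrow> real^2^2"
  assumes "(h has_vector_derivative D) (at t)"
  shows "((\<lambda>t. det (h t)) has_field_derivative
     D$1$1 * h t$2$2 + h t$1$1 * D$2$2 - (D$1$2 * h t$2$1 + h t$1$2 * D$2$1)) (at t)"
  unfolding det_2
  by (rule derivative_eq_intros has_field_derivative_entry[OF assms] refl | simp)+

lemma has_field_derivative_trace_2:
  fixes h :: "real \<Rightarrow> real^2^2"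
  assumes "(h has_vector_derivative D) (at t)"
  shows "((\<lambda>t. trace (h t)) has_field_derivative trace D) (at t)"
  unfolding trace_2
  by (rule derivative_eq_intros has_field_derivative_entry[OF assms] refl | simp)+

subsection \<open>First integrals\<close>

lemma matrix_inv_inverse:
  assumes "invertible A"
  shows "A ** matrix_inv A = mat 1" "matrix_inv A ** A = mat 1"
  using someI_ex[OF assms[unfolded invertible_def]] by (simp_all add: matrix_inv_def)

text \<open>Since \<open>h t\<close> is invertible, \<open>K\<close> is the only solution of
  \<open>h t ** A = D\<close>. Explicit solutions can thus be checked without computing an
  inverse.\<close>

lemma kasner_K_eqI:
  assumes "invertible (h t)" "(h has_vector_derivative D) (at t)" "h t ** A = D"
  shows "kasner_K h t = A"
proof -
  have "matrix_inv (h t) ** (h t ** A) = A"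
    using assms(1) by (simp add: matrix_mul_assoc matrix_inv_inverse)
  then show ?thesis
    using assms(2,3) by (simp add: kasner_K_def vector_derivative_at)
qed

lemma mult_kasner_K:
  assumes "invertible (h t)"
  shows "h t ** kasner_K h t = vector_derivative h (at t)"
  using assms by (simp add: kasner_K_def matrix_mul_assoc matrix_inv_inverse)

lemma kasner_Khat_square:
  "trace (kasner_Khat h t ** kasner_Khat h t) = (kasner_Xi h t)\<^sup>2 / 2 - 2 * det (kasner_K h t)"
  unfolding kasner_Khat_def kasner_Xi_def by (rule trace_square_traceless_part_2)

lemma kasner_Xi_square_minus_trace:
  fixes h :: "real \<Rightarrow> real^2^2"
  shows "(kasner_Xi h t)\<^sup>2 - trace (kasner_K h t ** kasner_K h t) = 2 * det (kasner_K h t)"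
  by (simp add: trace_square_2 kasner_Xi_def)

lemma kasner_Delta_deriv:
  fixes h :: "real \<Rightarrow> real^2^2"
  assumes "invertible (h t)" "h differentiable (at t)"
  shows "(kasner_Delta h has_field_derivative kasner_Delta h t * kasner_Xi h t) (at t)"
proof -
  have "(h has_vector_derivative h t ** kasner_K h t) (at t)"
    using assms by (simp add: mult_kasner_K vector_derivative_works)
  from has_field_derivative_det_2[OF this] show ?thesis
    unfolding kasner_Delta_def[abs_def]
    by (simp add: matrix_mult_nth_2 det_2 kasner_Xi_def trace_2 algebra_simps)
qed

lemma kasner_K_deriv:
  assumes "kasner_solution J h" "t \<in> J"
  shows "(kasner_K h has_vector_derivative
           det (kasner_K h t) *\<^sub>R mat 1 - (kasner_Xi h t / 2) *\<^sub>R kasner_K h t) (at t)"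
proof -
  let ?D = "vector_derivative (kasner_K h) (at t)"
  have "2 *\<^sub>R ?D + kasner_Xi h t *\<^sub>R kasner_K h t = (2 * det (kasner_K h t)) *\<^sub>R mat 1"
    using assms unfolding kasner_solution_def by (simp add: kasner_Xi_square_minus_trace)
  then have "?D = det (kasner_K h t) *\<^sub>R mat 1 - (kasner_Xi h t / 2) *\<^sub>R kasner_K h t"
    by (simp add: matrix_eq_2_iff mat_def field_simps)
  moreover have "(kasner_K h has_vector_derivative ?D) (at t)"
    using assms unfolding kasner_solution_def by (simp add: vector_derivative_works)
  ultimately show ?thesis by simp
qed

text \<open>The derivative of \<open>det K\<close> is the trace of \<open>adj K ** K'\<close>. As
  \<open>adj K\<close> has trace \<Xi> and \<open>adj K ** K\<close> has trace
  \<open>2 * det K\<close>, the two terms of \<open>K'\<close> contribute \<Xi> \<open>det K\<close>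
  with opposite signs.\<close>

lemma kasner_det_K_deriv:
  assumes "kasner_solution J h" "t \<in> J"
  shows "((\<lambda>t. det (kasner_K h t)) has_field_derivative 0) (at t)"
  using has_field_derivative_det_2[OF kasner_K_deriv[OF assms]]
  by (simp add: mat_def kasner_Xi_def trace_2 det_2 field_simps)

lemma kasner_Xi_deriv:
  assumes "kasner_solution J h" "t \<in> J"
  shows "(kasner_Xi h has_field_derivative
           2 * det (kasner_K h t) - (kasner_Xi h t)\<^sup>2 / 2) (at t)"
proof -
  have "trace (det (kasner_K h t) *\<^sub>R mat 1 - (kasner_Xi h t / 2) *\<^sub>R kasner_K h t)
      = 2 * det (kasner_K h t) - (kasner_Xi h t)\<^sup>2 / 2"
    by (simp add: trace_2 mat_def kasner_Xi_def field_simps power2_eq_square)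
  with has_field_derivative_trace_2[OF kasner_K_deriv[OF assms]] show ?thesis
    unfolding kasner_Xi_def[abs_def] by simp
qed

text \<open>Let \<open>S\<close> be the trace of the square of \<open>Khat\<close>. With
  \<open>det K\<close> constant, the equation for \<Xi> gives \<open>S' = -\<close> \<Xi>
  \<open>S\<close>, while \<Delta> grows at the opposite logarithmic rate \<Xi>. Hence \<Delta>
  \<open>S\<close> is constant.\<close>

lemma kasner_beta_deriv:
  assumes "kasner_solution J h" "t \<in> J"
  shows "(kasner_beta h has_field_derivative 0) (at t)"
proof -
  have Delta: "(kasner_Delta h has_field_derivative kasner_Delta h t * kasner_Xi h t) (at t)"
    using assms by (intro kasner_Delta_deriv) (auto simp: kasner_solution_def)
  have "((\<lambda>t. - kasner_Delta h t * ((kasner_Xi h t)\<^sup>2 / 2 - 2 * det (kasner_K h t)))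
     has_field_derivative 0) (at t)"
    by (rule derivative_eq_intros Delta kasner_Xi_deriv[OF assms] kasner_det_K_deriv[OF assms] refl
        | simp add: field_simps power2_eq_square)+
  then show ?thesis
    unfolding kasner_beta_def[abs_def] kasner_Khat_square .
qed

lemma kasner_first_integrals:
  assumes sol: "kasner_solution J h"
  shows "kasner_beta h constant_on J" "kasner_C h constant_on J"
proof -
  \<comment> \<open>A vanishing derivative forces a constant only on a connected set, which is why
    the domain is an interval.\<close>
  have J: "open J" "connected J"
    using sol by (auto simp: kasner_solution_def is_interval_connected)
  show "kasner_beta h constant_on J"
    using kasner_beta_deriv[OF sol] J by (intro has_field_derivative_0_imp_constant_on)
  have "(kasner_C h has_field_derivative 0) (at t)" if "t \<in> J" for t
    unfolding kasner_C_def[abs_def]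
    using DERIV_cmult[OF kasner_det_K_deriv[OF sol that], of 4] by simp
  then show "kasner_C h constant_on J"
    using J by (intro has_field_derivative_0_imp_constant_on)
qed

text \<open>Square Jacobi's formula and insert \<Xi>\<open>^2 = 4 * det K + 2 * S\<close>, where
  \<open>S\<close> is the trace of the square of \<open>Khat\<close>; the last term turns into
  \<beta> after multiplication by \<Delta>\<open>^2\<close>.\<close>

lemma kasner_Delta_ode:
  assumes "kasner_solution J h" "t \<in> J"
  shows "kasner_Delta h differentiable (at t)"
    and "(deriv (kasner_Delta h) t)\<^sup>2 =
           kasner_C h t * (kasner_Delta h t)\<^sup>2 - 2 * kasner_beta h t * kasner_Delta h t"
proof -
  have D: "(kasner_Delta h has_field_derivative kasner_Delta h t * kasner_Xi h t) (at t)"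
    using assms by (intro kasner_Delta_deriv) (auto simp: kasner_solution_def)
  then show "kasner_Delta h differentiable (at t)"
    by (metis field_differentiable_def field_differentiable_imp_differentiable)
  have "deriv (kasner_Delta h) t = kasner_Delta h t * kasner_Xi h t"
    using D by (rule DERIV_imp_deriv)
  then show "(deriv (kasner_Delta h) t)\<^sup>2 =
      kasner_C h t * (kasner_Delta h t)\<^sup>2 - 2 * kasner_beta h t * kasner_Delta h t"
    by (simp add: kasner_C_def kasner_beta_def kasner_Khat_square field_simps power2_eq_square)
qed

subsection \<open>Diagonal solutions\<close>

definition diag2 :: "real \<Rightarrow> real \<Rightarrow> real^2^2" where
  "diag2 a b = vector [vector [a, 0], vector [0, b]]"

lemma diag2_nth [simp]:
  "diag2 a b $ 1 $ 1 = a" "diag2 a b $ 1 $ 2 = 0" "diag2 a b $ 2 $ 1 = 0" "diag2 a b $ 2 $ 2 = b"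
  by (simp_all add: diag2_def)

lemma diag2_mult: "diag2 a b ** diag2 c d = diag2 (a * c) (b * d)"
  by (simp add: matrix_eq_2_iff matrix_mult_nth_2)

lemma has_vector_derivative_diag2:
  assumes "(a has_field_derivative a') (at t)" "(b has_field_derivative b') (at t)"
  shows "((\<lambda>t. diag2 (a t) (b t)) has_vector_derivative diag2 a' b') (at t)"
proof -
  have diag2_eq: "diag2 x y = x *\<^sub>R diag2 1 0 + y *\<^sub>R diag2 0 1" for x y
    by (simp add: matrix_eq_2_iff)
  have "((\<lambda>t. a t *\<^sub>R diag2 1 0 + b t *\<^sub>R diag2 0 1) has_vector_derivative
      a' *\<^sub>R diag2 1 0 + b' *\<^sub>R diag2 0 1) (at t)"
    using assms by (auto intro!: derivative_eq_intros)
  then show ?thesis by (subst (1 2) diag2_eq)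
qed

text \<open>For diagonal \<open>K\<close> with entries \<open>p\<close> and \<open>q\<close> the
  equation reads \<open>2 p' = p q - p^2\<close>, and likewise for \<open>q\<close>. As
  \<open>p q = 4 m\<close> is constant, this is a Riccati equation, linearised by
  \<open>p = 2 u' / u\<close> with \<open>u'' = m u\<close>; then
  \<open>q = 4 m / p = 2 v' / v\<close> with \<open>v = u'\<close>.\<close>

lemma diagonal_kasner_solution:
  fixes u v :: "real \<Rightarrow> real" and m s :: real
  assumes J: "open J" "is_interval J" "J \<noteq> {}" and s: "s \<noteq> 0"
    and u: "\<And>t. t \<in> J \<Longrightarrow> (u has_field_derivative v t) (at t)"
    and v: "\<And>t. t \<in> J \<Longrightarrow> (v has_field_derivative m * u t) (at t)"
    and nz: "\<And>t. t \<in> J \<Longrightarrow> u t \<noteq> 0" "\<And>t. t \<in> J \<Longrightarrow> v t \<noteq> 0"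
  defines "h \<equiv> \<lambda>t. diag2 (s * (u t)\<^sup>2) ((v t)\<^sup>2)"
  shows "kasner_solution J h"
    and "t \<in> J \<Longrightarrow> kasner_K h t = diag2 (2 * v t / u t) (2 * m * u t / v t)"
proof -
  let ?K = "\<lambda>t. diag2 (2 * v t / u t) (2 * m * u t / v t)"
  have inv: "invertible (h t)" if "t \<in> J" for t
    using nz[OF that] s by (simp add: invertible_det_nz det_2 h_def)
  have h': "(h has_vector_derivative diag2 (2 * s * u t * v t) (2 * m * u t * v t)) (at t)"
    if "t \<in> J" for t
    unfolding h_def
    by (rule has_vector_derivative_diag2)
      (rule derivative_eq_intros u[OF that] v[OF that] refl | simp)+
  have K: "kasner_K h t = ?K t" if "t \<in> J" for t
    by (rule kasner_K_eqI[OF inv h'])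
      (use that nz[OF that] in \<open>simp_all add: h_def diag2_mult power2_eq_square mult_ac\<close>)
  have K': "(kasner_K h has_vector_derivative
      diag2 (2 * m - 2 * (v t / u t)\<^sup>2) (2 * m - 2 * (m * u t / v t)\<^sup>2)) (at t)"
    (is "(_ has_vector_derivative ?K' t) _") if t: "t \<in> J" for t
  \<comment> \<open>The formula for \<open>K\<close> is known only on \<open>J\<close>; openness
    makes it valid near \<open>t\<close>, so it may be differentiated there.\<close>
  proof (rule has_vector_derivative_transform_within_open[OF _ J(1) t])
    show "(?K has_vector_derivative ?K' t) (at t)"
      by (rule has_vector_derivative_diag2)
        (rule derivative_eq_intros u[OF t] v[OF t] refl
          | use nz[OF t] in \<open>simp add: field_simps power2_eq_square\<close>)+
  qed (simp add: K)
  show "kasner_solution J h"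
    unfolding kasner_solution_def
  proof (intro conjI ballI)
    fix t assume t: "t \<in> J"
    show "transpose (h t) = h t"
      by (simp add: h_def transpose_def matrix_eq_2_iff)
    show "invertible (h t)" using inv[OF t] .
    show "h differentiable (at t)" "kasner_K h differentiable (at t)"
      using h'[OF t] K'[OF t] by (auto intro: differentiableI_vector)
    show "2 *\<^sub>R vector_derivative (kasner_K h) (at t) + kasner_Xi h t *\<^sub>R kasner_K h t
        = ((kasner_Xi h t)\<^sup>2 - trace (kasner_K h t ** kasner_K h t)) *\<^sub>R mat 1"
      unfolding vector_derivative_at[OF K'[OF t]] kasner_Xi_def K[OF t] diag2_mult
      using nz[OF t]
      by (simp add: matrix_eq_2_iff trace_2 det_2 mat_def field_simps power2_eq_square)
  qed (use J in auto)
  show "t \<in> J \<Longrightarrow> kasner_K h t = ?K t" by (rule K)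
qed

text \<open>The last conclusion makes the two eigenvalues \<open>2 v / u\<close> and \<open>2 m u / v\<close> of \<open>K\<close> distinct; it
  rules out exponential \<open>u\<close>.\<close>

lemma linear_ode_solution_exists:
  fixes m :: real
  obtains J :: "real set" and u v :: "real \<Rightarrow> real"
  where "open J" "is_interval J" "J \<noteq> {}"
    and "\<And>t. t \<in> J \<Longrightarrow> (u has_field_derivative v t) (at t)"
    and "\<And>t. t \<in> J \<Longrightarrow> (v has_field_derivative m * u t) (at t)"
    and "\<And>t. t \<in> J \<Longrightarrow> u t \<noteq> 0" "\<And>t. t \<in> J \<Longrightarrow> v t \<noteq> 0"
    and "\<And>t. t \<in> J \<Longrightarrow> (v t)\<^sup>2 \<noteq> m * (u t)\<^sup>2"
proof -
  \<comment> \<open>The linear equation conserves \<open>v^2 - m u^2\<close>. The solutions chosen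
    below give it the nonzero value 1 for \<open>m = 0\<close> and \<open>k^2\<close>
    otherwise.\<close>
  consider (zero) "m = 0" | (pos) k where "k > 0" "m = k\<^sup>2" | (neg) k where "k > 0" "m = - k\<^sup>2"
  proof (cases m "0 :: real" rule: linorder_cases)
    case less
    then show ?thesis using neg[of "sqrt (- m)"] by simp
  next
    case greater
    then show ?thesis using pos[of "sqrt m"] by simp
  qed (use zero in blast)
  then show ?thesis
  proof cases
    case zero
    show ?thesis
      by (rule that[of "{0<..}" "\<lambda>t. t" "\<lambda>_. 1"])
        (auto simp: zero is_interval_oi intro!: derivative_eq_intros)
  next
    case (pos k)
    have "(k * cosh (k * t))\<^sup>2 \<noteq> m * (sinh (k * t))\<^sup>2" for t
      using pos by (simp add: power_mult_distrib cosh_square_eq)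
    then show ?thesis
      by (intro that[of "{0<..}" "\<lambda>t. sinh (k * t)" "\<lambda>t. k * cosh (k * t)"])
        (use pos in \<open>auto simp: is_interval_oi power2_eq_square intro!: derivative_eq_intros\<close>)
  next
    case (neg k)
    \<comment> \<open>On this quarter period sine and cosine are both positive, so neither
      \<open>u\<close> nor \<open>v\<close> vanishes.\<close>
    let ?J = "{0<..<pi / (2 * k)}"
    have J: "0 < k * t" "k * t < pi / 2" if "t \<in> ?J" for t
      using that neg by (auto simp: field_simps)
    have sin_cos: "sin (k * t) > 0" "cos (k * t) > 0" if "t \<in> ?J" for t
      using J[OF that] by (auto intro!: sin_gt_zero cos_gt_zero_pi)
    have "(k * cos (k * t))\<^sup>2 \<noteq> m * (sin (k * t))\<^sup>2" for t
    proof -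
      have "(k * cos (k * t))\<^sup>2 - m * (sin (k * t))\<^sup>2 = k\<^sup>2"
        by (simp add: neg power_mult_distrib cos_squared_eq algebra_simps)
      then show ?thesis using neg by auto
    qed
    moreover have "?J \<noteq> {}" using neg by (simp add: not_le)
    moreover have "sin (k * t) \<noteq> 0" "k * cos (k * t) \<noteq> 0" if "t \<in> ?J" for t
      using sin_cos[OF that] neg by simp_all
    ultimately show ?thesis
      by (intro that[of ?J "\<lambda>t. sin (k * t)" "\<lambda>t. k * cos (k * t)"])
        (auto simp: neg is_interval_oo power2_eq_square intro!: derivative_eq_intros)
  qed
qed

section \<open>Realising every value of C with either sign of \<beta>\<close>

lemma kasner_solution_with_C_and_sign:
  fixes c s :: real
  assumes "s \<noteq> 0"
  obtains J h where "kasner_solution J h"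
    and "\<And>t. t \<in> J \<Longrightarrow> kasner_C h t = c" "\<And>t. t \<in> J \<Longrightarrow> sgn (kasner_beta h t) = - sgn s"
proof -
  \<comment> \<open>The diagonal solution has \<open>det K = 4 * m\<close>, hence
    \<open>C = 16 * m\<close>.\<close>
  define m where "m = c / 16"
  obtain J u v where J: "open J" "is_interval J" "J \<noteq> {}"
    and u: "\<And>t. t \<in> J \<Longrightarrow> (u has_field_derivative v t) (at t)"
    and v: "\<And>t. t \<in> J \<Longrightarrow> (v has_field_derivative m * u t) (at t)"
    and nz: "\<And>t. t \<in> J \<Longrightarrow> u t \<noteq> 0" "\<And>t. t \<in> J \<Longrightarrow> v t \<noteq> 0"
    and distinct_eigenvalues: "\<And>t. t \<in> J \<Longrightarrow> (v t)\<^sup>2 \<noteq> m * (u t)\<^sup>2"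
    by (rule linear_ode_solution_exists[of m]) blast
  define h where "h = (\<lambda>t. diag2 (s * (u t)\<^sup>2) ((v t)\<^sup>2))"
  have sol: "kasner_solution J h"
    unfolding h_def by (rule diagonal_kasner_solution(1)[OF J assms u v nz])
  show ?thesis
  proof (rule that[OF sol])
    fix t assume t: "t \<in> J"
    have K: "kasner_K h t = diag2 (2 * v t / u t) (2 * m * u t / v t)"
      unfolding h_def by (rule diagonal_kasner_solution(2)[OF J assms u v nz t])
    show "kasner_C h t = c"
      using nz[OF t] by (simp add: kasner_C_def K det_2 m_def)
    \<comment> \<open>This is half the squared difference of the two real eigenvalues of
      \<open>K\<close>, so it is positive once they differ.\<close>
    have "trace (kasner_Khat h t ** kasner_Khat h t) = 2 * (v t / u t - m * u t / v t)\<^sup>2"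
      unfolding kasner_Khat_square kasner_Xi_def K using nz[OF t]
      by (simp add: trace_2 det_2 field_simps power2_eq_square)
    moreover have "v t / u t - m * u t / v t \<noteq> 0"
      using nz[OF t] distinct_eigenvalues[OF t] by (simp add: field_simps power2_eq_square)
    ultimately have "trace (kasner_Khat h t ** kasner_Khat h t) > 0" by simp
    moreover have "(u t * v t)\<^sup>2 > 0" using nz[OF t] by simp
    moreover have "kasner_Delta h t = s * (u t * v t)\<^sup>2"
      by (simp add: kasner_Delta_def h_def det_2 power_mult_distrib)
    ultimately show "sgn (kasner_beta h t) = - sgn s"
      by (simp only: kasner_beta_def sgn_mult sgn_pos sgn_minus mult_1_right)
  qed
qed

text \<open>Logical independence is expressed by attaining each real value of C both with \<beta>
  \<le> 0 and with its negation; solutions live on nonempty intervals, so these pointwise claims are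
  not vacuous.\<close>

theorem lemma4p2:
  "(\<forall>J h. kasner_solution J h \<longrightarrow>
      (\<forall>t\<in>J. kasner_K h t = kasner_Khat h t + (kasner_Xi h t / 2) *\<^sub>R mat 1 \<and>
              trace (kasner_Khat h t) = 0) \<and>
      kasner_beta h constant_on J \<and>
      kasner_C h constant_on J \<and>
      (\<forall>t\<in>J. kasner_Delta h differentiable (at t) \<and>
         (deriv (kasner_Delta h) t)\<^sup>2 =
           kasner_C h t * (kasner_Delta h t)\<^sup>2 - 2 * kasner_beta h t * kasner_Delta h t) \<and>
      (\<forall>t\<in>J. kasner_C h t = 2 * ((kasner_Xi h t)\<^sup>2 - trace (kasner_K h t ** kasner_K h t)) \<and>
              (kasner_Xi h t)\<^sup>2 - trace (kasner_K h t ** kasner_K h t) = 2 * det (kasner_K h t)) \<and>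
      (\<forall>t\<in>J. sgn (kasner_beta h t) =
                - sgn (kasner_Delta h t) * sgn (trace (kasner_Khat h t ** kasner_Khat h t)) \<and>
              (\<exists>l m. eigenvalue_pair (kasner_K h t) l m) \<and>
              (\<forall>l m. eigenvalue_pair (kasner_K h t) l m \<longrightarrow>
                 complex_of_real (trace (kasner_Khat h t ** kasner_Khat h t)) = (l - m)\<^sup>2 / 2 \<and>
                 complex_of_real (kasner_C h t) = 4 * (l * m)))) \<and>
   (\<forall>c. (\<exists>J h. kasner_solution J h \<and> (\<forall>t\<in>J. kasner_C h t = c \<and> kasner_beta h t \<le> 0)) \<and>
        (\<exists>J h. kasner_solution J h \<and> (\<forall>t\<in>J. kasner_C h t = c \<and> \<not> kasner_beta h t \<le> 0)))"
proof (intro conjI allI impI ballI)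
  fix J h assume sol: "kasner_solution J h"
  show "kasner_beta h constant_on J" "kasner_C h constant_on J"
    by (fact kasner_first_integrals[OF sol])+
  fix t
  show "kasner_K h t = kasner_Khat h t + (kasner_Xi h t / 2) *\<^sub>R mat 1"
    by (simp add: kasner_Khat_def)
  show "trace (kasner_Khat h t) = 0"
    by (simp add: kasner_Khat_def kasner_Xi_def trace_2 mat_def)
  show "(kasner_Xi h t)\<^sup>2 - trace (kasner_K h t ** kasner_K h t) = 2 * det (kasner_K h t)"
    by (fact kasner_Xi_square_minus_trace)
  then show "kasner_C h t = 2 * ((kasner_Xi h t)\<^sup>2 - trace (kasner_K h t ** kasner_K h t))"
    by (simp add: kasner_C_def)
  show "sgn (kasner_beta h t) =
      - sgn (kasner_Delta h t) * sgn (trace (kasner_Khat h t ** kasner_Khat h t))"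
    by (simp add: kasner_beta_def sgn_mult)
  show "\<exists>l m. eigenvalue_pair (kasner_K h t) l m"
    by (fact eigenvalue_pair_exists)
  show "complex_of_real (trace (kasner_Khat h t ** kasner_Khat h t)) = (l - m)\<^sup>2 / 2"
    and "complex_of_real (kasner_C h t) = 4 * (l * m)"
    if pair: "eigenvalue_pair (kasner_K h t) l m" for l m
  proof -
    show "complex_of_real (trace (kasner_Khat h t ** kasner_Khat h t)) = (l - m)\<^sup>2 / 2"
      unfolding eigenvalue_pair_discriminant[OF pair] kasner_Khat_square kasner_Xi_def by simp
    show "complex_of_real (kasner_C h t) = 4 * (l * m)"
      using pair by (simp add: eigenvalue_pair_iff kasner_C_def)
  qed
  assume "t \<in> J"
  then show "kasner_Delta h differentiable (at t)"
    and "(deriv (kasner_Delta h) t)\<^sup>2 =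
           kasner_C h t * (kasner_Delta h t)\<^sup>2 - 2 * kasner_beta h t * kasner_Delta h t"
    by (fact kasner_Delta_ode[OF sol])+
next
  fix c
  \<comment> \<open>With \<open>s = 1\<close> the matrix \<open>h\<close> is positive definite:
    \<Delta> is positive and \<beta> negative.\<close>
  obtain J h where "kasner_solution J h"
    and "\<And>t. t \<in> J \<Longrightarrow> kasner_C h t = c" "\<And>t. t \<in> J \<Longrightarrow> sgn (kasner_beta h t) = - sgn (1 :: real)"
    by (rule kasner_solution_with_C_and_sign[of 1 c]) auto
  then show "\<exists>J h. kasner_solution J h \<and> (\<forall>t\<in>J. kasner_C h t = c \<and> kasner_beta h t \<le> 0)"
    by (fastforce simp: sgn_if split: if_splits)
next
  fix c
  \<comment> \<open>With \<open>s = - 1\<close> the matrix \<open>h\<close> is indefinite: \<Delta>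
    is negative and \<beta> positive.\<close>
  obtain J h where "kasner_solution J h"
    and "\<And>t. t \<in> J \<Longrightarrow> kasner_C h t = c" "\<And>t. t \<in> J \<Longrightarrow> sgn (kasner_beta h t) = - sgn (- 1 :: real)"
    by (rule kasner_solution_with_C_and_sign[of "- 1" c]) auto
  then show "\<exists>J h. kasner_solution J h \<and> (\<forall>t\<in>J. kasner_C h t = c \<and> \<not> kasner_beta h t \<le> 0)"
    by (fastforce simp: sgn_if split: if_splits)
qed

end
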